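(* If there is an unbounded tower (of any cardinality), then there is a set of reals $X$ of cardinality $\mathfrak{b}$ which satisfies $\mathsf{S}_1(\Gamma,\Gamma)$.
   Context: $[\omega]^{\omega}$ is the family of infinite subsets of $\omega$. For sets $a,b\subseteq\omega$, $a\subseteq^* b$ means that $a\setminus b$ is finite. A tower of cardinality $\kappa$ is a set $T\subseteq[\omega]^{\omega}$ which can be enumerated bijectively as $\{x_\alpha:\alpha<\kappa\}$ such that $x_\beta\subseteq^* x_\alpha$ for all $\alpha<\beta<\kappa$. A set $T\subseteq[\omega]^{\omega}$ is unbounded if for each $g\in\omega^\omega$ there is $x\in T$ such that for infinitely many $n$, $g(n)$ is less than the $n$-th element of $x$ (in increasing order). For $f,g\in\omega^\omega$, $f\le^* g$ means $f(n)\le g(n)$ for all but finitely many $n$. $\mathfrak{b}$ is the minimal cardinality of a subset of $\omega^\omega$ that is not bounded with respect to $\le^*$. A set of reals is a subset of $\mathbb{R}$ with the subspace topology (subsets of $P(\omega)\cong 2^\omega$ are regarded as sets of reals by embedding the Cantor space in $\mathbb{R}$). A family $\mathcal{U}$ of subsets of $X$ is a point-cofinite cover of $X$ if $\mathcal{U}$ is infinite and for each $x\in X$, $\{U\in\mathcal{U}:x\in U\}$ is a cofinite subset of $\mathcal{U}$. $\Gamma$ denotes the family of all point-cofinite covers of $X$ by open sets. $X$ satisfies $\mathsf{S}_1(\Gamma,\Gamma)$ if for all $\mathcal{U}_0,\mathcal{U}_1,\dots\in\Gamma$ there are $U_0\in\mathcal{U}_0,U_1\in\mathcal{U}_1,\dots$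 such that $\{U_n:n\in\omega\}\in\Gamma$. *)

theory Defs
  imports "HOL-Analysis.Analysis"
begin

unbundle cardinal_syntax

definition almost_subset :: "nat set \<Rightarrow> nat set \<Rightarrow> bool" (infix "\<subseteq>\<^sup>*" 50)
  where "a \<subseteq>\<^sup>* b \<longleftrightarrow> finite (a - b)"

text \<open>A cardinal number is represented, as in the library, by a well-order \<open>\<kappa>\<close> satisfying
  \<open>Card_order \<kappa>\<close>; the ordinals below it are the elements of \<open>Field \<kappa>\<close>. The underlying
  type \<open>'k\<close> is arbitrary.\<close>

definition tower :: "'k rel \<Rightarrow> nat set set \<Rightarrow> bool"
  where "tower \<kappa> T \<longleftrightarrow>
    Card_order \<kappa> \<and> (\<forall>a\<in>T. infinite a) \<and>
    (\<exists>x. bij_betw x (Field \<kappa>) T \<and>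
         (\<forall>\<alpha> \<beta>. (\<alpha>, \<beta>) \<in> \<kappa> \<and> \<alpha> \<noteq> \<beta> \<longrightarrow> x \<beta> \<subseteq>\<^sup>* x \<alpha>))"

text \<open>For an infinite \<open>a\<close>, \<open>enumerate a n\<close> is the \<open>n\<close>-th element of \<open>a\<close> in
  increasing order, counting from 0.\<close>

definition unbounded_family :: "nat set set \<Rightarrow> bool"
  where "unbounded_family T \<longleftrightarrow>
    (\<forall>g :: nat \<Rightarrow> nat. \<exists>a\<in>T. \<exists>\<^sub>\<infinity>n. g n < enumerate a n)"

definition le_star :: "(nat \<Rightarrow> nat) \<Rightarrow> (nat \<Rightarrow> nat) \<Rightarrow> bool" (infix "\<le>\<^sup>*" 50)
  where "f \<le>\<^sup>* g \<longleftrightarrow> (\<forall>\<^sub>\<infinity>n. f n \<le> g n)"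

definition le_star_bounded :: "(nat \<Rightarrow> nat) set \<Rightarrow> bool"
  where "le_star_bounded B \<longleftrightarrow> (\<exists>g. \<forall>f\<in>B. f \<le>\<^sup>* g)"

text \<open>The choice only selects a representative: by \<open>bounding_number\<close> below the
  result is determined up to \<open>=o\<close>.\<close>

definition bounding_number :: "(nat \<Rightarrow> nat) rel" ("\<bb>")
  where "\<bb> = |SOME B. \<not> le_star_bounded B \<and> (\<forall>C. \<not> le_star_bounded C \<longrightarrow> |B| \<le>o |C| )|"

lemma not_le_star_bounded_UNIV: "\<not> le_star_bounded UNIV"
proof
  assume "le_star_bounded UNIV"
  then obtain g where "(\<lambda>n. Suc (g n)) \<le>\<^sup>* g"
    unfolding le_star_bounded_def by blast
  then show False
    by (simp add: le_star_def)
qed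

lemma bounding_number:
  shows "\<exists>B. \<not> le_star_bounded B \<and> \<bb> = |B|"
    and "\<not> le_star_bounded C \<Longrightarrow> \<bb> \<le>o |C|"
proof -
  let ?R = "card_of ` {B. \<not> le_star_bounded B}"
  have "\<exists>r\<in>?R. \<forall>r'\<in>?R. r \<le>o r'"
    by (rule exists_minim_Card_order) (use not_le_star_bounded_UNIV card_of_Card_order in auto)
  then have ex: "\<exists>B. \<not> le_star_bounded B \<and> (\<forall>C. \<not> le_star_bounded C \<longrightarrow> |B| \<le>o |C| )"
    by auto
  show "\<exists>B. \<not> le_star_bounded B \<and> \<bb> = |B|"
    unfolding bounding_number_def using someI_ex[OF ex] by blast
  show "\<bb> \<le>o |C|" if "\<not> le_star_bounded C"
    unfolding bounding_number_def using someI_ex[OF ex] that by blast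
qed

text \<open>The whole space is not excluded as a member of a cover.\<close>

definition point_cofinite_cover :: "'a topology \<Rightarrow> 'a set set \<Rightarrow> bool"
  where "point_cofinite_cover X \<U> \<longleftrightarrow>
    infinite \<U> \<and> \<U> \<subseteq> Pow (topspace X) \<and>
    (\<forall>x\<in>topspace X. finite (\<U> - {U\<in>\<U>. x \<in> U}))"

definition Gamma_covers :: "'a topology \<Rightarrow> 'a set set set" ("\<Gamma>")
  where "\<Gamma> X = {\<U>. point_cofinite_cover X \<U> \<and> (\<forall>U\<in>\<U>. openin X U)}"

definition S1 :: "'a set set set \<Rightarrow> 'a set set set \<Rightarrow> bool" ("S\<^sub>1")
  where "S\<^sub>1 \<A> \<B> \<longleftrightarrow>
    (\<forall>\<U> :: nat \<Rightarrow> 'a set set. (\<forall>n. \<U> n \<in> \<A>) \<longrightarrow>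
       (\<exists>U :: nat \<Rightarrow> 'a set. (\<forall>n. U n \<in> \<U> n) \<and> range U \<in> \<B>))"

end

theory Submission
  imports Defs
begin

text \<open>
  Two steps produce the set of reals.

  \<^bold>\<open>From a tower of any length to a chain of length \<open>\<bb>\<close>.\<close>
  Measure the growth of an infinite \<open>a \<subseteq> \<omega>\<close> by the function sending \<open>n\<close> to the least element
  of \<open>a\<close> that is \<open>\<ge> n\<close>. In contrast to the increasing enumeration it is antitone:
  removing elements and changing finitely many makes it larger modulo \<open>\<le>\<^sup>*\<close>. A tower is thus
  a \<open>\<le>\<^sup>*\<close>-increasing unbounded sequence of functions. Compare it with an unbounded
  \<open>\<le>\<^sup>*\<close>-increasing sequence \<open>s\<close> of monotone functions of length \<open>\<bb>\<close>. If some member \<open>a\<close> of the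
  tower escapes every \<open>s \<gamma>\<close>, then the infinite sets of those \<open>n\<close> where \<open>a\<close> exceeds \<open>s \<gamma>\<close>
  decrease with \<open>\<gamma>\<close>, and they are unbounded since \<open>s\<close> is
  (\<open>unbounded_chain_if_undominated\<close>). Otherwise, the first member of the tower that escapes
  \<open>s \<gamma>\<close>, taken for each \<open>\<gamma>\<close>, yields a cofinal part of the tower, of the right length
  (\<open>unbounded_chain_if_dominated\<close>).

  \<^bold>\<open>From a chain to \<open>S\<^sub>1(\<Gamma>, \<Gamma>)\<close>.\<close>
  Let \<open>S\<close> consist of the chain \<open>y\<close> and all finite sets. Given countably many point-cofinite open
  covers \<open>V n 0, V n 1, \<dots>\<close>, the finite sets yield intervals \<open>[M i, M (i + 1))\<close> such that every
  point missing the \<open>i\<close>-th interval lies in some late member of each of the first covers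
  (\<open>ex_interval_sequence\<close>). As the chain is unbounded, some \<open>y \<gamma>\<close> misses infinitely many of these
  intervals (\<open>infinitely_many_gaps\<close>). Modulo finite sets, so do all later \<open>y \<beta>\<close> and all finite
  sets, along the same intervals. There remain the \<open>y \<beta>\<close> with \<open>\<beta> < \<gamma>\<close>; they are fewer
  than \<open>\<bb>\<close>, so one function bounds the indices from which on they belong to the members of the
  covers. Choosing for the \<open>n\<close>-th cover a late interval missed by \<open>y \<gamma>\<close>, beyond that bound,
  serves all points simultaneously (\<open>ex_infinite_selection_sets\<close>). Infinitely many choices remain
  for every \<open>n\<close>, so the chosen members can be made distinct.
\<close>

section \<open>Growth of infinite sets of natural numbers\<close>

definition next_elem :: "nat set \<Rightarrow> nat \<Rightarrow> nat"
  where "next_elem a n = (LEAST m. m \<in> a \<and> n \<le> m)"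

lemma next_elem:
  assumes "infinite a"
  shows next_elem_mem: "next_elem a n \<in> a" and next_elem_ge: "n \<le> next_elem a n"
proof -
  obtain m where "n \<le> m" "m \<in> a"
    using assms by (metis infinite_nat_iff_unbounded_le)
  then have "next_elem a n \<in> a \<and> n \<le> next_elem a n"
    unfolding next_elem_def using LeastI[of "\<lambda>m. m \<in> a \<and> n \<le> m" m] by blast
  then show "next_elem a n \<in> a" "n \<le> next_elem a n"
    by auto
qed

lemma next_elem_le: "m \<in> a \<Longrightarrow> n \<le> m \<Longrightarrow> next_elem a n \<le> m"
  unfolding next_elem_def by (intro Least_le) simp

lemma next_elem_mono: "infinite a \<Longrightarrow> m \<le> n \<Longrightarrow> next_elem a m \<le> next_elem a n"
  by (rule next_elem_le[OF next_elem_mem]) (auto intro: order_trans[OF _ next_elem_ge])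

lemma le_star_trans:
  assumes "f \<le>\<^sup>* g" and "g \<le>\<^sup>* h"
  shows "f \<le>\<^sup>* h"
  using assms unfolding le_star_def by eventually_elim simp

text \<open>
  From some point on, the next element of \<open>b\<close> is also an element of \<open>a\<close>. For enumerations this
  would fail: adding \<open>c\<close> elements to a set shifts its enumeration by \<open>c\<close>.
\<close>

lemma next_elem_almost_subset:
  assumes "b \<subseteq>\<^sup>* a" and "infinite b"
  shows "next_elem a \<le>\<^sup>* next_elem b"
proof -
  obtain N where N: "\<And>m. m \<in> b - a \<Longrightarrow> m < N"
    using assms(1) unfolding almost_subset_def finite_nat_set_iff_bounded by auto
  have "next_elem a n \<le> next_elem b n" if "N \<le> n" for n
  proof (rule next_elem_le)
    show "next_elem b n \<in> a"
      using N[of "next_elem b n"] next_elem[OF assms(2), of n] that by fastforce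
  qed (rule next_elem_ge[OF assms(2)])
  then show ?thesis
    unfolding le_star_def MOST_nat_le by blast
qed

text \<open>
  A bound \<open>g\<close> for the next elements also bounds enumerations, since the successor of an element
  \<open>m\<close> is the next element after \<open>m + 1\<close>: iterating \<open>m \<mapsto> g (m + 1)\<close> from \<open>0\<close>, forced to increase
  strictly, gives a sequence \<open>M\<close> which, started late enough, keeps above the enumeration of \<open>a\<close>. The starting index \<open>c\<close> depends
  on \<open>a\<close>; passing to \<open>M (2 * n)\<close> absorbs every fixed \<open>c\<close>.
\<close>

lemma not_le_star_bounded_next_elem:
  assumes "unbounded_family T" and inf: "\<And>a. a \<in> T \<Longrightarrow> infinite a"
  shows "\<not> le_star_bounded (next_elem ` T)"
proof
  assume "le_star_bounded (next_elem ` T)"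
  then obtain g where g: "\<And>a. a \<in> T \<Longrightarrow> next_elem a \<le>\<^sup>* g"
    unfolding le_star_bounded_def by auto
  define M where "M = rec_nat 0 (\<lambda>_ m. max (Suc m) (g (Suc m)))"
  have M_Suc: "M (Suc i) = max (Suc (M i)) (g (Suc (M i)))" for i
    unfolding M_def by simp
  have M_strict: "strict_mono M"
    unfolding strict_mono_Suc_iff M_Suc by (simp add: less_max_iff_disj)
  obtain a where a: "a \<in> T" and large: "\<exists>\<^sub>\<infinity>n. M (2 * n) < enumerate a n"
    using assms(1)[unfolded unbounded_family_def, rule_format, of "\<lambda>n. M (2 * n)"] by blast
  note infa = inf[OF a]
  obtain N where N: "\<And>n. N \<le> n \<Longrightarrow> next_elem a n \<le> g n"
    using g[OF a] unfolding le_star_def MOST_nat_le by blast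
  define c where "c = enumerate a N"
  have "N \<le> c"
    unfolding c_def by (rule le_enumerate[OF infa])
  have step: "enumerate a (N + j) \<le> M (c + j)" for j
  proof (induction j)
    case 0
    show ?case
      using strict_mono_imp_increasing[OF M_strict, of c] by (simp add: c_def)
  next
    case (Suc j)
    let ?m = "M (c + j)"
    have "c \<le> ?m"
      using strict_mono_imp_increasing[OF M_strict, of "c + j"] by linarith
    have "enumerate a (N + Suc j) = next_elem a (Suc (enumerate a (N + j)))"
      unfolding next_elem_def using infa
      by (simp add: enumerate_Suc'' Suc_le_eq)
    also have "\<dots> \<le> next_elem a (Suc ?m)"
      by (rule next_elem_mono[OF infa]) (use Suc.IH in simp)
    also have "\<dots> \<le> g (Suc ?m)"
      by (rule N) (use \<open>N \<le> c\<close> \<open>c \<le> ?m\<close> in simp)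
    also have "\<dots> \<le> M (c + Suc j)"
      by (simp add: M_Suc)
    finally show ?case .
  qed
  have "enumerate a n \<le> M (2 * n)" if "c \<le> n" for n
  proof -
    have "enumerate a n \<le> M (c + (n - N))"
      using step[of "n - N"] that \<open>N \<le> c\<close> by simp
    also have "\<dots> \<le> M (2 * n)"
      by (rule monoD[OF strict_mono_mono[OF M_strict]]) (use that in simp)
    finally show ?thesis .
  qed
  then have "\<forall>\<^sub>\<infinity>n. \<not> M (2 * n) < enumerate a n"
    unfolding MOST_nat_le by (meson not_less)
  with large show False
    by (simp add: frequently_def)
qed

section \<open>The bounding number and monotone scales\<close>

lemma le_star_bounded_smaller_card:
  assumes "|C| <o \<bb>"
  shows "le_star_bounded (f ` C)"
  using assms bounding_number(2)[of "f ` C"] card_of_image[of f C]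
  by (meson not_ordLess_ordLeq ordLeq_transitive)

lemma Card_order_bounding_number: "Card_order \<bb>"
  by (metis bounding_number(1) card_of_Card_order)

lemma le_star_bounded_finite:
  assumes "finite B"
  shows "le_star_bounded B"
proof -
  have "\<forall>f\<in>B. f \<le>\<^sup>* (\<lambda>n. \<Sum>f\<in>B. f n)"
    unfolding le_star_def using assms by (auto intro!: always_eventually member_le_sum)
  then show ?thesis
    unfolding le_star_bounded_def by blast
qed

lemma infinite_Field_bounding_number: "infinite (Field \<bb>)"
  by (metis bounding_number(1) Field_card_of le_star_bounded_finite)

lemma ex_mono_majorant:
  fixes g :: "nat \<Rightarrow> nat"
  shows "\<exists>h. mono h \<and> (\<forall>n. g n \<le> h n)"
proof (intro exI conjI allI)
  show "mono (\<lambda>n. \<Sum>i\<le>n. g i)"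
    by (intro monoI sum_mono2) auto
  show "g n \<le> (\<Sum>i\<le>n. g i)" for n
    by (rule member_le_sum) auto
qed

text \<open>
  By recursion along a well-order of type \<open>\<bb>\<close> on an unbounded set \<open>B\<close>: the value at \<open>\<delta> \<in> B\<close>
  dominates \<open>\<delta>\<close> itself, which makes the sequence unbounded, and all earlier values, which is
  possible because proper initial segments have fewer than \<open>\<bb>\<close> elements.
\<close>

lemma ex_mono_scale:
  "\<exists>s. (\<forall>\<gamma>\<in>Field \<bb>. mono (s \<gamma>)) \<and> (\<forall>\<gamma> \<delta>. (\<gamma>, \<delta>) \<in> \<bb> \<longrightarrow> s \<gamma> \<le>\<^sup>* s \<delta>) \<and>
       \<not> le_star_bounded (s ` Field \<bb>)"
proof -
  obtain B where B: "\<not> le_star_bounded B" and bB: "\<bb> = |B|"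
    using bounding_number(1) by blast
  have FB: "Field \<bb> = B"
    by (simp add: bB Field_card_of)
  let ?P = "\<lambda>f \<delta> r. \<delta> \<in> B \<longrightarrow> mono r \<and> \<delta> \<le>\<^sup>* r \<and> (\<forall>\<gamma>\<in>underS \<bb> \<delta>. f \<gamma> \<le>\<^sup>* r)"
  have "\<exists>s. \<forall>\<delta>. ?P s \<delta> (s \<delta>)"
  proof (rule dependent_wf_choice[of "\<bb> - Id"])
    show "wf (\<bb> - Id)"
      using Card_order_bounding_number unfolding card_order_on_def well_order_on_def by blast
  next
    show "?P f x r = ?P g x r" if "\<And>z. (z, x) \<in> \<bb> - Id \<Longrightarrow> f z = g z" for f g x r
      using that by (auto simp: underS_def)
  next
    fix x f
    show "\<exists>r. ?P f x r"
    proof (cases "x \<in> B")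
      case True
      then have "|underS \<bb> x| <o \<bb>"
        using card_of_underS[OF Card_order_bounding_number] FB by blast
      then obtain g where g: "\<And>y. y \<in> underS \<bb> x \<Longrightarrow> f y \<le>\<^sup>* g"
        using le_star_bounded_smaller_card[of _ f] unfolding le_star_bounded_def by blast
      obtain h where h: "mono h" "\<And>n. max (g n) (x n) \<le> h n"
        using ex_mono_majorant[of "\<lambda>n. max (g n) (x n)"] by blast
      have "x \<le>\<^sup>* h" "g \<le>\<^sup>* h"
        using h(2) unfolding le_star_def by auto
      then show ?thesis
        using h(1) g le_star_trans by blast
    qed simp
  qed
  then obtain s where s: "\<And>\<delta>. ?P s \<delta> (s \<delta>)"
    by blast
  have "s \<gamma> \<le>\<^sup>* s \<delta>" if "(\<gamma>, \<delta>) \<in> \<bb>" for \<gamma> \<delta>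
  proof (cases "\<gamma> = \<delta>")
    case False
    then show ?thesis
      using s[of \<delta>] that FB FieldI2[OF that] by (auto simp: underS_def)
  qed (simp add: le_star_def)
  moreover have "\<not> le_star_bounded (s ` Field \<bb>)"
  proof
    assume "le_star_bounded (s ` Field \<bb>)"
    then obtain g where "\<And>\<gamma>. \<gamma> \<in> B \<Longrightarrow> s \<gamma> \<le>\<^sup>* g"
      unfolding le_star_bounded_def FB by auto
    then have "\<forall>\<gamma>\<in>B. \<gamma> \<le>\<^sup>* g"
      using s le_star_trans by blast
    with B show False
      unfolding le_star_bounded_def by blast
  qed
  ultimately show ?thesis
    using s FB by blast
qed

section \<open>Unbounded chains of length equal to the bounding number\<close>

text \<open>
  An unbounded tower of length \<open>\<bb>\<close> given by its enumeration, which need not be injective. Since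
  \<open>\<bb>\<close> is a well-order on functions, the indices have type \<open>nat \<Rightarrow> nat\<close>.
\<close>

definition unbounded_chain :: "((nat \<Rightarrow> nat) \<Rightarrow> nat set) \<Rightarrow> bool"
  where "unbounded_chain y \<longleftrightarrow>
    (\<forall>\<gamma>\<in>Field \<bb>. infinite (y \<gamma>)) \<and> (\<forall>\<gamma> \<delta>. (\<gamma>, \<delta>) \<in> \<bb> \<longrightarrow> y \<delta> \<subseteq>\<^sup>* y \<gamma>) \<and>
    \<not> le_star_bounded ((\<lambda>\<gamma>. next_elem (y \<gamma>)) ` Field \<bb>)"

text \<open>
  A set \<open>a\<close> that escapes every member of a scale turns the scale into a chain of sets. Suppose \<open>g\<close>
  bounded the next elements of all sets \<open>{n. s \<gamma> n < next_elem a n}\<close>. Moving from \<open>n\<close> to the next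
  element \<open>k\<close> of such a set only increases the monotone \<open>s \<gamma>\<close>, and there
  \<open>s \<gamma> k < next_elem a k \<le> next_elem a (g n)\<close>; so \<open>next_elem a \<circ> g\<close> would bound the scale.
\<close>

lemma unbounded_chain_if_undominated:
  assumes mono_s: "\<And>\<gamma>. \<gamma> \<in> Field \<bb> \<Longrightarrow> mono (s \<gamma>)"
    and incr: "\<And>\<gamma> \<delta>. (\<gamma>, \<delta>) \<in> \<bb> \<Longrightarrow> s \<gamma> \<le>\<^sup>* s \<delta>"
    and unb: "\<not> le_star_bounded (s ` Field \<bb>)"
    and infa: "infinite a"
    and undom: "\<And>\<gamma>. \<gamma> \<in> Field \<bb> \<Longrightarrow> \<not> next_elem a \<le>\<^sup>* s \<gamma>"
  shows "unbounded_chain (\<lambda>\<gamma>. {n. s \<gamma> n < next_elem a n})"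
  unfolding unbounded_chain_def
proof (intro conjI ballI allI impI notI)
  let ?y = "\<lambda>\<gamma>. {n. s \<gamma> n < next_elem a n}"
  have inf: "infinite (?y \<gamma>)" if "\<gamma> \<in> Field \<bb>" for \<gamma>
    using undom[OF that] unfolding le_star_def frequently_cofinite[symmetric]
    by (simp add: not_eventually not_le)
  {
    fix \<gamma> assume "\<gamma> \<in> Field \<bb>" "finite (?y \<gamma>)"
    with inf show False by blast
  next
    fix \<gamma> \<delta> assume "(\<gamma>, \<delta>) \<in> \<bb>"
    then have "finite {n. \<not> s \<gamma> n \<le> s \<delta> n}"
      using incr unfolding le_star_def eventually_cofinite by blast
    then show "?y \<delta> \<subseteq>\<^sup>* ?y \<gamma>"
      unfolding almost_subset_def by (rule finite_subset[rotated]) auto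
  next
    assume "le_star_bounded ((\<lambda>\<gamma>. next_elem (?y \<gamma>)) ` Field \<bb>)"
    then obtain g where g: "\<And>\<gamma>. \<gamma> \<in> Field \<bb> \<Longrightarrow> next_elem (?y \<gamma>) \<le>\<^sup>* g"
      unfolding le_star_bounded_def by auto
    have "s \<gamma> \<le>\<^sup>* (\<lambda>n. next_elem a (g n))" if \<gamma>: "\<gamma> \<in> Field \<bb>" for \<gamma>
      unfolding le_star_def
    proof (rule MOST_mono[OF g[OF \<gamma>, unfolded le_star_def]])
      fix n assume n: "next_elem (?y \<gamma>) n \<le> g n"
      let ?k = "next_elem (?y \<gamma>) n"
      have "s \<gamma> n \<le> s \<gamma> ?k"
        by (rule monoD[OF mono_s[OF \<gamma>] next_elem_ge[OF inf[OF \<gamma>]]])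
      also have "\<dots> \<le> next_elem a ?k"
        using next_elem_mem[OF inf[OF \<gamma>], of n] by simp
      also have "\<dots> \<le> next_elem a (g n)"
        by (rule next_elem_mono[OF infa n])
      finally show "s \<gamma> n \<le> next_elem a (g n)" .
    qed
    with unb show False
      unfolding le_star_bounded_def by blast
  }
qed

text \<open>
  For \<open>\<gamma>\<close> in \<open>\<bb>\<close> let \<open>m \<gamma>\<close> be the first index at which the tower escapes \<open>s \<gamma>\<close>. As \<open>s\<close> increases,
  so does \<open>m\<close>. Every \<open>x \<alpha>\<close> lies below some \<open>s \<gamma>\<close>, and \<open>x (m \<gamma>)\<close> does not, which forces
  \<open>\<alpha>\<close> to precede \<open>m \<gamma>\<close>: the range of \<open>m\<close> is cofinal, so the subsequence is still unbounded.
\<close>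

lemma unbounded_chain_if_dominated:
  fixes \<kappa> :: "'k rel"
  assumes wo: "Well_order \<kappa>"
    and inf: "\<And>\<alpha>. \<alpha> \<in> Field \<kappa> \<Longrightarrow> infinite (x \<alpha>)"
    and decr: "\<And>\<alpha> \<beta>. (\<alpha>, \<beta>) \<in> \<kappa> \<Longrightarrow> x \<beta> \<subseteq>\<^sup>* x \<alpha>"
    and unb: "\<not> le_star_bounded ((\<lambda>\<alpha>. next_elem (x \<alpha>)) ` Field \<kappa>)"
    and incr: "\<And>\<gamma> \<delta>. (\<gamma>, \<delta>) \<in> \<bb> \<Longrightarrow> s \<gamma> \<le>\<^sup>* s \<delta>"
    and dom: "\<And>\<alpha>. \<alpha> \<in> Field \<kappa> \<Longrightarrow> \<exists>\<gamma>\<in>Field \<bb>. next_elem (x \<alpha>) \<le>\<^sup>* s \<gamma>"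
  shows "\<exists>y. unbounded_chain y"
proof -
  interpret wo_rel \<kappa>
    using wo by (simp add: wo_rel_def)
  let ?A = "\<lambda>\<gamma>. {\<alpha> \<in> Field \<kappa>. \<not> next_elem (x \<alpha>) \<le>\<^sup>* s \<gamma>}"
  have A_ne: "?A \<gamma> \<noteq> {}" for \<gamma>
    using unb unfolding le_star_bounded_def by auto
  define m where "m \<gamma> = minim (?A \<gamma>)" for \<gamma>
  have m_in: "m \<gamma> \<in> Field \<kappa>" and m_esc: "\<not> next_elem (x (m \<gamma>)) \<le>\<^sup>* s \<gamma>" for \<gamma>
    using minim_in[OF _ A_ne[of \<gamma>]] unfolding m_def by auto
  have m_least: "(m \<gamma>, \<alpha>) \<in> \<kappa>" if "\<alpha> \<in> ?A \<gamma>" for \<alpha> \<gamma>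
    unfolding m_def by (rule minim_least[OF _ that]) auto
  have "unbounded_chain (\<lambda>\<gamma>. x (m \<gamma>))"
    unfolding unbounded_chain_def
  proof (intro conjI ballI allI impI notI)
    fix \<gamma> assume "finite (x (m \<gamma>))"
    with inf[OF m_in] show False by blast
  next
    fix \<gamma> \<delta> assume "(\<gamma>, \<delta>) \<in> \<bb>"
    then have "m \<delta> \<in> ?A \<gamma>"
      using m_in m_esc incr le_star_trans by blast
    then show "x (m \<delta>) \<subseteq>\<^sup>* x (m \<gamma>)"
      by (intro decr m_least)
  next
    assume "le_star_bounded ((\<lambda>\<gamma>. next_elem (x (m \<gamma>))) ` Field \<bb>)"
    then obtain g where g: "\<And>\<gamma>. \<gamma> \<in> Field \<bb> \<Longrightarrow> next_elem (x (m \<gamma>)) \<le>\<^sup>* g"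
      unfolding le_star_bounded_def by auto
    have "next_elem (x \<alpha>) \<le>\<^sup>* g" if \<alpha>: "\<alpha> \<in> Field \<kappa>" for \<alpha>
    proof -
      obtain \<gamma> where \<gamma>: "\<gamma> \<in> Field \<bb>" "next_elem (x \<alpha>) \<le>\<^sup>* s \<gamma>"
        using dom[OF \<alpha>] by blast
      have "(m \<gamma>, \<alpha>) \<notin> \<kappa>"
        using decr next_elem_almost_subset inf[OF \<alpha>] \<gamma>(2) m_esc le_star_trans by blast
      then have "(\<alpha>, m \<gamma>) \<in> \<kappa>"
        using TOTALS \<alpha> m_in by blast
      then have "next_elem (x \<alpha>) \<le>\<^sup>* next_elem (x (m \<gamma>))"
        by (intro next_elem_almost_subset decr inf m_in)
      then show ?thesis
        using g[OF \<gamma>(1)] le_star_trans by blast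
    qed
    with unb show False
      unfolding le_star_bounded_def by blast
  qed
  then show ?thesis by blast
qed

lemma ex_unbounded_chain:
  fixes \<kappa> :: "'k rel"
  assumes "tower \<kappa> T" and "unbounded_family T"
  shows "\<exists>y. unbounded_chain y"
proof -
  have card: "Card_order \<kappa>" and infT: "\<And>a. a \<in> T \<Longrightarrow> infinite a"
    using assms(1) by (simp_all add: tower_def)
  obtain x where x: "bij_betw x (Field \<kappa>) T"
    and decr: "\<forall>\<alpha> \<beta>. (\<alpha>, \<beta>) \<in> \<kappa> \<and> \<alpha> \<noteq> \<beta> \<longrightarrow> x \<beta> \<subseteq>\<^sup>* x \<alpha>"
    using assms(1) unfolding tower_def by (elim conjE exE)
  have T: "T = x ` Field \<kappa>"
    using x by (simp add: bij_betw_def)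
  have decr': "x \<beta> \<subseteq>\<^sup>* x \<alpha>" if "(\<alpha>, \<beta>) \<in> \<kappa>" for \<alpha> \<beta>
    using decr that by (cases "\<alpha> = \<beta>") (simp_all add: almost_subset_def)
  have unb: "\<not> le_star_bounded ((\<lambda>\<alpha>. next_elem (x \<alpha>)) ` Field \<kappa>)"
    using not_le_star_bounded_next_elem[OF assms(2) infT] by (simp add: T image_image)
  obtain s where s: "\<And>\<gamma>. \<gamma> \<in> Field \<bb> \<Longrightarrow> mono (s \<gamma>)"
      "\<And>\<gamma> \<delta>. (\<gamma>, \<delta>) \<in> \<bb> \<Longrightarrow> s \<gamma> \<le>\<^sup>* s \<delta>" "\<not> le_star_bounded (s ` Field \<bb>)"
    using ex_mono_scale by blast
  show ?thesis
  proof (cases "\<exists>a\<in>T. \<forall>\<gamma>\<in>Field \<bb>. \<not> next_elem a \<le>\<^sup>* s \<gamma>")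
    case True
    then obtain a where "a \<in> T" "\<And>\<gamma>. \<gamma> \<in> Field \<bb> \<Longrightarrow> \<not> next_elem a \<le>\<^sup>* s \<gamma>"
      by blast
    then show ?thesis
      using unbounded_chain_if_undominated[OF s infT] by blast
  next
    case False
    show ?thesis
    proof (rule unbounded_chain_if_dominated[OF _ _ decr' unb s(2)])
      show "Well_order \<kappa>"
        using card unfolding card_order_on_def by blast
    qed (use False infT T in auto)
  qed
qed

section \<open>Selecting from point-cofinite covers of a chain\<close>

text \<open>
  A set \<open>t\<close> missing \<open>[m, m')\<close> agrees below \<open>m'\<close> with a subset of \<open>{..<m}\<close>. There are finitely many
  such subsets and all of them are points of \<open>S\<close>, so all lie in \<open>V n k\<close> for a common large \<open>k\<close>;
  as \<open>V n k\<close> is relatively open in \<open>S\<close>, a sufficiently large \<open>m'\<close> brings \<open>t\<close> into \<open>V n k\<close> as well.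
  The bounds \<open>n \<le> i\<close> and \<open>i \<le> k\<close> let a single sequence of intervals serve all covers, with
  arbitrarily late members of each.
\<close>

lemma ex_interval_step:
  fixes V :: "nat \<Rightarrow> nat \<Rightarrow> nat set set"
  assumes fin: "\<And>s. finite s \<Longrightarrow> s \<in> S"
    and opn: "\<And>n k s. s \<in> S \<Longrightarrow> s \<in> V n k \<Longrightarrow>
      \<exists>m. \<forall>t\<in>S. t \<inter> {..<m} = s \<inter> {..<m} \<longrightarrow> t \<in> V n k"
    and cof: "\<And>n s. s \<in> S \<Longrightarrow> \<forall>\<^sub>\<infinity>k. s \<in> V n k"
  shows "\<exists>m'>m. \<forall>n\<le>i. \<exists>k\<ge>i. \<forall>t\<in>S. t \<inter> {m..<m'} = {} \<longrightarrow> t \<in> V n k"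
proof -
  have "\<exists>k\<ge>i. \<forall>\<^sub>\<infinity>m'. \<forall>t\<in>S. t \<inter> {m..<m'} = {} \<longrightarrow> t \<in> V n k" for n
  proof -
    have "\<forall>\<^sub>\<infinity>k. \<forall>s\<in>Pow {..<m}. s \<in> V n k"
      by (rule eventually_ball_finite) (auto intro!: cof fin intro: finite_subset)
    then obtain k0 where k0: "\<And>k s. k0 \<le> k \<Longrightarrow> s \<subseteq> {..<m} \<Longrightarrow> s \<in> V n k"
      unfolding MOST_nat_le by blast
    define k where "k = max i k0"
    have k: "k \<ge> i" "\<And>s. s \<subseteq> {..<m} \<Longrightarrow> s \<in> V n k"
      using k0[of k] by (auto simp: k_def)
    have "\<forall>\<^sub>\<infinity>m'. \<forall>s\<in>Pow {..<m}. \<forall>t\<in>S. t \<inter> {..<m'} = s \<longrightarrow> t \<in> V n k"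
    proof (rule eventually_ball_finite)
      show "finite (Pow {..<m})"
        by simp
      show "\<forall>s\<in>Pow {..<m}. \<forall>\<^sub>\<infinity>m'. \<forall>t\<in>S. t \<inter> {..<m'} = s \<longrightarrow> t \<in> V n k"
      proof
        fix s assume "s \<in> Pow {..<m}"
        then have s: "s \<subseteq> {..<m}" "s \<in> S"
          using fin finite_subset by auto
        obtain m0 where m0: "\<And>t. t \<in> S \<Longrightarrow> t \<inter> {..<m0} = s \<inter> {..<m0} \<Longrightarrow> t \<in> V n k"
          using opn[OF s(2) k(2)[OF s(1)]] by blast
        have "\<forall>t\<in>S. t \<inter> {..<m'} = s \<longrightarrow> t \<in> V n k" if "m0 \<le> m'" for m'
          using m0 that by fastforce
        then show "\<forall>\<^sub>\<infinity>m'. \<forall>t\<in>S. t \<inter> {..<m'} = s \<longrightarrow> t \<in> V n k"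
          unfolding MOST_nat_le by blast
      qed
    qed
    then have "\<forall>\<^sub>\<infinity>m'. \<forall>t\<in>S. t \<inter> {m..<m'} = {} \<longrightarrow> t \<in> V n k"
    proof (rule MOST_mono, intro ballI impI)
      fix m' t
      assume *: "\<forall>s\<in>Pow {..<m}. \<forall>t\<in>S. t \<inter> {..<m'} = s \<longrightarrow> t \<in> V n k"
        and t: "t \<in> S" "t \<inter> {m..<m'} = {}"
      have "t \<inter> {..<m'} \<in> Pow {..<m}"
        using t(2) by (fastforce simp: not_le[symmetric])
      with * t(1) show "t \<in> V n k" by blast
    qed
    with k(1) show ?thesis by blast
  qed
  then have "\<forall>n. \<exists>k. k \<ge> i \<and> (\<forall>\<^sub>\<infinity>m'. \<forall>t\<in>S. t \<inter> {m..<m'} = {} \<longrightarrow> t \<in> V n k)"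
    by blast
  from choice[OF this] obtain kf where kf: "\<And>n. kf n \<ge> i"
      "\<And>n. \<forall>\<^sub>\<infinity>m'. \<forall>t\<in>S. t \<inter> {m..<m'} = {} \<longrightarrow> t \<in> V n (kf n)"
    by blast
  have "\<forall>\<^sub>\<infinity>m'. \<forall>n\<in>{..i}. \<forall>t\<in>S. t \<inter> {m..<m'} = {} \<longrightarrow> t \<in> V n (kf n)"
    by (rule eventually_ball_finite) (use kf(2) in auto)
  then obtain N where N: "\<And>m'. N \<le> m' \<Longrightarrow> \<forall>n\<in>{..i}. \<forall>t\<in>S. t \<inter> {m..<m'} = {} \<longrightarrow> t \<in> V n (kf n)"
    unfolding MOST_nat_le by blast
  have "max N (Suc m) > m" "\<forall>n\<le>i. \<exists>k\<ge>i. \<forall>t\<in>S. t \<inter> {m..<max N (Suc m)} = {} \<longrightarrow> t \<in> V n k"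
    using N[of "max N (Suc m)"] kf(1) by auto
  then show ?thesis by blast
qed

lemma ex_interval_sequence:
  fixes V :: "nat \<Rightarrow> nat \<Rightarrow> nat set set"
  assumes fin: "\<And>s. finite s \<Longrightarrow> s \<in> S"
    and opn: "\<And>n k s. s \<in> S \<Longrightarrow> s \<in> V n k \<Longrightarrow>
      \<exists>m. \<forall>t\<in>S. t \<inter> {..<m} = s \<inter> {..<m} \<longrightarrow> t \<in> V n k"
    and cof: "\<And>n s. s \<in> S \<Longrightarrow> \<forall>\<^sub>\<infinity>k. s \<in> V n k"
  shows "\<exists>M. strict_mono M \<and>
    (\<forall>i. \<forall>n\<le>i. \<exists>k\<ge>i. \<forall>t\<in>S. t \<inter> {M i..<M (Suc i)} = {} \<longrightarrow> t \<in> V n k)"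
proof -
  obtain F where F: "\<And>m i. F m i > m"
    "\<And>m i. \<forall>n\<le>i. \<exists>k\<ge>i. \<forall>t\<in>S. t \<inter> {m..<F m i} = {} \<longrightarrow> t \<in> V n k"
    using ex_interval_step[of S V, OF fin opn cof] by metis
  define M where "M = rec_nat 0 (\<lambda>i m. F m i)"
  have M_Suc: "M (Suc i) = F (M i) i" for i
    by (simp add: M_def)
  have "strict_mono M"
    unfolding strict_mono_Suc_iff M_Suc using F(1) by blast
  moreover have "\<forall>i. \<forall>n\<le>i. \<exists>k\<ge>i. \<forall>t\<in>S. t \<inter> {M i..<M (Suc i)} = {} \<longrightarrow> t \<in> V n k"
    unfolding M_Suc using F(2) by blast
  ultimately show ?thesis by blast
qed

text \<open>
  Since \<open>n \<le> M n\<close>, a set without elements in \<open>[n, M (n + 1)]\<close> misses the interval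
  \<open>[M n, M (n + 1))\<close>.
\<close>

lemma infinitely_many_gaps:
  assumes "infinite a" and esc: "\<not> next_elem a \<le>\<^sup>* (\<lambda>n. M (Suc n))" and M: "strict_mono M"
  shows "infinite {i. a \<inter> {M i..<M (Suc i)} = {}}"
proof -
  have "infinite {n. M (Suc n) < next_elem a n}"
    using esc unfolding le_star_def by (simp add: eventually_cofinite not_le)
  moreover have "{n. M (Suc n) < next_elem a n} \<subseteq> {i. a \<inter> {M i..<M (Suc i)} = {}}"
  proof safe
    fix n j assume n: "M (Suc n) < next_elem a n" and j: "j \<in> a" "j \<in> {M n..<M (Suc n)}"
    have "n \<le> j"
      using strict_mono_imp_increasing[OF M, of n] j(2) by simp
    then show "j \<in> {}"
      using next_elem_le[OF j(1)] n j(2) by fastforce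
  qed
  ultimately show ?thesis
    using infinite_super by blast
qed

text \<open>
  The combinatorial core of the selection principle: here \<open>K n\<close> is an infinite set of admissible
  indices in the \<open>n\<close>-th cover, and any choice of admissible indices works. That the sets are
  infinite leaves the freedom needed to select distinct members of the covers later.
\<close>

lemma ex_infinite_selection_sets:
  fixes V :: "nat \<Rightarrow> nat \<Rightarrow> nat set set"
  assumes y: "unbounded_chain y"
    and S: "S = y ` Field \<bb> \<union> {s. finite s}"
    and opn: "\<And>n k s. s \<in> S \<Longrightarrow> s \<in> V n k \<Longrightarrow>
      \<exists>m. \<forall>t\<in>S. t \<inter> {..<m} = s \<inter> {..<m} \<longrightarrow> t \<in> V n k"
    and cof: "\<And>n s. s \<in> S \<Longrightarrow> \<forall>\<^sub>\<infinity>k. s \<in> V n k"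
  shows "\<exists>K. (\<forall>n. infinite (K n)) \<and>
    (\<forall>k. (\<forall>n. k n \<in> K n) \<longrightarrow> (\<forall>s\<in>S. \<forall>\<^sub>\<infinity>n. s \<in> V n (k n)))"
proof -
  have fin: "s \<in> S" if "finite s" for s
    using that S by blast
  obtain M where M: "strict_mono M" and
    exk: "\<And>i n. n \<le> i \<Longrightarrow> \<exists>k\<ge>i. \<forall>t\<in>S. t \<inter> {M i..<M (Suc i)} = {} \<longrightarrow> t \<in> V n k"
    using ex_interval_sequence[of S V, OF fin opn cof] by blast
  obtain kf where kf: "\<And>i n. n \<le> i \<Longrightarrow> kf n i \<ge> i"
    "\<And>i n t. n \<le> i \<Longrightarrow> t \<in> S \<Longrightarrow> t \<inter> {M i..<M (Suc i)} = {} \<Longrightarrow> t \<in> V n (kf n i)"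
    using exk by metis
  obtain \<gamma> where \<gamma>: "\<gamma> \<in> Field \<bb>" "\<not> next_elem (y \<gamma>) \<le>\<^sup>* (\<lambda>n. M (Suc n))"
    using y unfolding unbounded_chain_def le_star_bounded_def by fastforce
  define I where "I = {i. y \<gamma> \<inter> {M i..<M (Suc i)} = {}}"
  have "infinite (y \<gamma>)"
    using y \<gamma>(1) unfolding unbounded_chain_def by blast
  then have infI: "infinite I"
    unfolding I_def using \<gamma>(2) M by (rule infinitely_many_gaps)
  \<comment> \<open>The points preceding \<open>y \<gamma>\<close> need not miss the intervals that \<open>y \<gamma>\<close> misses. For each of them the
      function \<open>f\<close> records from which index on it belongs to the members of the covers; being fewer
      than \<open>\<bb>\<close>, these functions have a common bound \<open>g\<close>.\<close>
  obtain f where f: "\<And>s n k. s \<in> S \<Longrightarrow> f s n \<le> k \<Longrightarrow> s \<in> V n k"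
    using cof unfolding MOST_nat_le by metis
  have "|underS \<bb> \<gamma>| <o \<bb>"
    by (rule card_of_underS[OF Card_order_bounding_number \<gamma>(1)])
  then obtain g where g: "\<And>\<beta>. \<beta> \<in> underS \<bb> \<gamma> \<Longrightarrow> f (y \<beta>) \<le>\<^sup>* g"
    using le_star_bounded_smaller_card[of _ "\<lambda>\<beta>. f (y \<beta>)"] unfolding le_star_bounded_def by blast
  define K where "K n = kf n ` {i \<in> I. n \<le> i \<and> g n \<le> i}" for n
  have "infinite (K n)" for n
    unfolding infinite_nat_iff_unbounded_le
  proof
    fix N
    obtain i where "i \<in> I" "max N (max n (g n)) \<le> i"
      using infI unfolding infinite_nat_iff_unbounded_le by blast
    then show "\<exists>k\<ge>N. k \<in> K n"
      using kf(1)[of n i] unfolding K_def by (intro exI[of _ "kf n i"]) auto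
  qed
  moreover have "\<forall>\<^sub>\<infinity>n. s \<in> V n (k n)" if k: "\<And>n. k n \<in> K n" and s: "s \<in> S" for k s
  proof -
    obtain i where i: "\<And>n. i n \<in> I" "\<And>n. n \<le> i n" "\<And>n. g n \<le> i n" "\<And>n. k n = kf n (i n)"
      using k unfolding K_def by (simp add: image_iff) metis
    consider "s \<subseteq>\<^sup>* y \<gamma>" | \<beta> where "s = y \<beta>" "\<beta> \<in> underS \<bb> \<gamma>"
    proof (cases "finite s")
      case True
      then show ?thesis
        using that(1) by (simp add: almost_subset_def)
    next
      case False
      then obtain \<beta> where \<beta>: "\<beta> \<in> Field \<bb>" "s = y \<beta>"
        using s S by blast
      have "wo_rel \<bb>"
        using Card_order_bounding_number by (simp add: wo_rel_def card_order_on_def)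
      show ?thesis
      proof (cases "(\<gamma>, \<beta>) \<in> \<bb>")
        case True
        then show ?thesis
          using that(1) y \<beta>(2) unfolding unbounded_chain_def by blast
      next
        case False
        then have "\<beta> \<in> underS \<bb> \<gamma>"
          using wo_rel.TOTALS[OF \<open>wo_rel \<bb>\<close>] \<beta>(1) \<gamma>(1) by (auto simp: underS_def)
        then show ?thesis
          using that(2) \<beta>(2) by blast
      qed
    qed
    then show ?thesis
    proof cases
      case 1
      then obtain N where N: "\<And>j. j \<in> s - y \<gamma> \<Longrightarrow> j < N"
        unfolding almost_subset_def finite_nat_set_iff_bounded by auto
      have "s \<in> V n (k n)" if "N \<le> n" for n
      proof -
        have "N \<le> M (i n)"
          using that i(2)[of n] strict_mono_imp_increasing[OF M, of "i n"] by linarith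
        then have "s \<inter> {M (i n)..<M (Suc (i n))} = {}"
          using i(1)[of n] N unfolding I_def by fastforce
        then show ?thesis
          unfolding i(4) by (intro kf(2) i(2) s)
      qed
      then show ?thesis
        unfolding MOST_nat_le by blast
    next
      case (2 \<beta>)
      have "f s \<le>\<^sup>* g"
        using g 2 by blast
      then show ?thesis
        unfolding le_star_def
      proof (rule MOST_mono)
        fix n assume "f s n \<le> g n"
        also have "g n \<le> k n"
          using i(3)[of n] kf(1)[OF i(2), of n] i(4)[of n] by linarith
        finally show "s \<in> V n (k n)"
          by (rule f[OF s])
      qed
    qed
  qed
  ultimately show ?thesis by blast
qed

lemma ex_inj_selector:
  fixes W :: "nat \<Rightarrow> 'a set"
  assumes "\<And>n. infinite (W n)"
  shows "\<exists>u. inj u \<and> (\<forall>n. u n \<in> W n)"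
proof -
  have "\<exists>u. \<forall>n. u n \<in> W n \<and> u n \<notin> u ` {..<n}"
  proof (rule dependent_wf_choice[of less_than])
    fix n and u :: "nat \<Rightarrow> 'a"
    have "infinite (W n - u ` {..<n})"
      using assms by simp
    then show "\<exists>r. r \<in> W n \<and> r \<notin> u ` {..<n}"
      using infinite_imp_nonempty by blast
  next
    fix f g :: "nat \<Rightarrow> 'a" and n r assume "\<And>z. (z, n) \<in> less_than \<Longrightarrow> f z = g z"
    then have "f ` {..<n} = g ` {..<n}"
      by (intro image_cong) auto
    then show "(r \<in> W n \<and> r \<notin> f ` {..<n}) = (r \<in> W n \<and> r \<notin> g ` {..<n})"
      by simp
  qed simp
  then obtain u where u: "\<And>n. u n \<in> W n" "\<And>n. u n \<notin> u ` {..<n}"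
    by blast
  have "inj u"
    by (rule linorder_injI) (use u(2) in \<open>metis imageI lessThan_iff\<close>)
  with u(1) show ?thesis by blast
qed

section \<open>Sets of natural numbers as real numbers\<close>

text \<open>
  Each digit weighs more than all later digits together (the tail from \<open>m\<close> on is at most
  \<open>3/2 * (1/3) ^ m\<close>), so sums of distinct powers of \<open>1/3\<close> determine their exponents.
\<close>

definition cantor_embed :: "nat set \<Rightarrow> real"
  where "cantor_embed s = (\<Sum>n. if n \<in> s then (1/3) ^ n else 0)"

lemma cantor_embed_bounds:
  shows cantor_embed_ge: "(\<Sum>n<m. if n \<in> s then (1/3) ^ n else 0) \<le> cantor_embed s"
    and cantor_embed_le: "cantor_embed s \<le> (\<Sum>n<m. if n \<in> s then (1/3) ^ n else 0) + 3/2 * (1/3) ^ m"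
proof -
  let ?d = "\<lambda>n. if n \<in> s then (1/3) ^ n else (0::real)"
  have geom: "summable (\<lambda>n. (1/3) ^ n :: real)"
    by (rule summable_geometric) simp
  have sum: "summable ?d"
    by (rule summable_comparison_test'[OF geom, of 0]) auto
  have split: "cantor_embed s = (\<Sum>n. ?d (n + m)) + (\<Sum>n<m. ?d n)"
    unfolding cantor_embed_def by (rule suminf_split_initial_segment[OF sum])
  have sum': "summable (\<lambda>n. ?d (n + m))"
    using sum by (rule summable_ignore_initial_segment)
  have "0 \<le> (\<Sum>n. ?d (n + m))"
    by (rule suminf_nonneg[OF sum']) auto
  then show "(\<Sum>n<m. ?d n) \<le> cantor_embed s"
    using split by simp
  have "(\<Sum>n. ?d (n + m)) \<le> (\<Sum>n. (1/3) ^ m * (1/3) ^ n)"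
    by (rule suminf_le[OF _ sum' summable_mult[OF geom]]) (auto simp: power_add)
  also have "\<dots> = (1/3) ^ m * (\<Sum>n. (1/3) ^ n)"
    by (rule suminf_mult[OF geom])
  also have "(\<Sum>n. (1/3) ^ n :: real) = 3/2"
    by (subst suminf_geometric) auto
  finally show "cantor_embed s \<le> (\<Sum>n<m. ?d n) + 3/2 * (1/3) ^ m"
    using split by (simp add: mult.commute)
qed

lemma cantor_embed_close:
  assumes "s \<inter> {..<m} = t \<inter> {..<m}"
  shows "\<bar>cantor_embed s - cantor_embed t\<bar> \<le> 3/2 * (1/3) ^ m"
proof -
  have "(\<Sum>n<m. if n \<in> s then (1/3) ^ n else 0 :: real) = (\<Sum>n<m. if n \<in> t then (1/3) ^ n else 0)"
    by (rule sum.cong) (use assms in auto)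
  then show ?thesis
    using cantor_embed_bounds[where m = m and s = s] cantor_embed_bounds[where m = m and s = t]
    by linarith
qed

lemma inj_cantor_embed: "inj cantor_embed"
proof -
  have less: "cantor_embed t < cantor_embed s"
    if n: "n \<in> s" "n \<notin> t" and agree: "s \<inter> {..<n} = t \<inter> {..<n}" for s t n
  proof -
    have "(\<Sum>i<n. if i \<in> s then (1/3) ^ i else 0 :: real) = (\<Sum>i<n. if i \<in> t then (1/3) ^ i else 0)"
      by (rule sum.cong) (use agree in auto)
    moreover have "(\<Sum>i<n. if i \<in> s then (1/3) ^ i else 0) + (1/3) ^ n \<le> cantor_embed s"
      using cantor_embed_ge[where m = "Suc n" and s = s] n(1) by simp
    moreover have "cantor_embed t \<le> (\<Sum>i<n. if i \<in> t then (1/3) ^ i else 0) + (1/3) ^ n / 2"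
      using cantor_embed_le[where m = "Suc n" and s = t] n(2) by simp
    moreover have "(1/3) ^ n > (0::real)"
      by simp
    ultimately show ?thesis
      by linarith
  qed
  show ?thesis
  proof (rule injI, rule ccontr)
    fix s t assume eq: "cantor_embed s = cantor_embed t" and "s \<noteq> t"
    then have "\<exists>n. n \<in> s \<longleftrightarrow> n \<notin> t"
      by blast
    define n where "n = (LEAST n. n \<in> s \<longleftrightarrow> n \<notin> t)"
    have n: "n \<in> s \<longleftrightarrow> n \<notin> t"
      unfolding n_def by (rule LeastI_ex) fact
    have "i \<in> s \<longleftrightarrow> i \<in> t" if "i < n" for i
      using not_less_Least[OF that[unfolded n_def]] by blast
    then have "s \<inter> {..<n} = t \<inter> {..<n}"
      by blast
    then show False
      using less[of n s t] less[of n t s] n eq by auto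
  qed
qed

text \<open>Continuity of the embedding, in terms of the basic open sets of the Cantor space.\<close>

lemma openin_cantor_embed_cylinder:
  assumes U: "openin (top_of_set (cantor_embed ` S)) U" and s: "cantor_embed s \<in> U"
  shows "\<exists>m. \<forall>t\<in>S. t \<inter> {..<m} = s \<inter> {..<m} \<longrightarrow> cantor_embed t \<in> U"
proof -
  obtain e where e: "e > 0" "\<And>z. z \<in> cantor_embed ` S \<Longrightarrow> dist z (cantor_embed s) < e \<Longrightarrow> z \<in> U"
    using U s unfolding openin_euclidean_subtopology_iff by blast
  obtain m where m: "(1/3) ^ m < e / (3/2)"
    using real_arch_pow_inv[of "e / (3/2)" "1/3"] e(1) by auto
  have "cantor_embed t \<in> U" if "t \<in> S" "t \<inter> {..<m} = s \<inter> {..<m}" for t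
  proof (rule e(2))
    show "dist (cantor_embed t) (cantor_embed s) < e"
      using cantor_embed_close[OF that(2)] m by (simp add: dist_real_def)
  qed (use that(1) in blast)
  then show ?thesis by blast
qed

section \<open>The selection principle for chains\<close>

text \<open>
  Each cover contains an injective sequence \<open>e n\<close>, which is again point-cofinite because every point
  avoids only finitely many members. Pulling these sequences back along the embedding gives the
  family \<open>V\<close> to which the combinatorial selection applies. A point-cofinite cover must be infinite,
  hence the injective selector.
\<close>

lemma S1_Gamma_cantor_embed:
  assumes y: "unbounded_chain y"
    and S: "S = y ` Field \<bb> \<union> {s. finite s}"
  shows "S\<^sub>1 (\<Gamma> (top_of_set (cantor_embed ` S))) (\<Gamma> (top_of_set (cantor_embed ` S)))"
  unfolding S1_def
proof (intro allI impI)
  let ?X = "cantor_embed ` S"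
  fix \<U> :: "nat \<Rightarrow> real set set"
  assume "\<forall>n. \<U> n \<in> \<Gamma> (top_of_set ?X)"
  then have \<U>: "\<And>n. infinite (\<U> n)" "\<And>n. \<U> n \<subseteq> Pow ?X"
      "\<And>n x. x \<in> ?X \<Longrightarrow> finite (\<U> n - {U \<in> \<U> n. x \<in> U})"
      "\<And>n U. U \<in> \<U> n \<Longrightarrow> openin (top_of_set ?X) U"
    unfolding Gamma_covers_def point_cofinite_cover_def by auto
  have "\<forall>n. \<exists>e :: nat \<Rightarrow> real set. inj e \<and> range e \<subseteq> \<U> n"
    using infinite_countable_subset[OF \<U>(1)] by blast
  then obtain e :: "nat \<Rightarrow> nat \<Rightarrow> real set"
    where inj_e: "\<And>n. inj (e n)" and range_e: "\<And>n. range (e n) \<subseteq> \<U> n"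
    by metis
  have e: "e n k \<in> \<U> n" for n k
    using range_e by blast
  define V where "V n k = {s. cantor_embed s \<in> e n k}" for n k
  have cof: "\<forall>\<^sub>\<infinity>k. s \<in> V n k" if "s \<in> S" for n s
  proof -
    have "finite {U \<in> \<U> n. cantor_embed s \<notin> U}"
      using \<U>(3)[of "cantor_embed s" n] that by (rule_tac finite_subset[rotated]) auto
    then have "finite (e n -` {U \<in> \<U> n. cantor_embed s \<notin> U})"
      using inj_e by (intro finite_vimageI)
    then show ?thesis
      unfolding eventually_cofinite V_def using e by (simp add: vimage_def)
  qed
  have opn: "\<exists>m. \<forall>t\<in>S. t \<inter> {..<m} = s \<inter> {..<m} \<longrightarrow> t \<in> V n k" if "s \<in> V n k" for n k s
    using openin_cantor_embed_cylinder[OF \<U>(4)[OF e], of s n k] that by (simp add: V_def)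
  have "\<exists>K. (\<forall>n. infinite (K n)) \<and>
      (\<forall>k. (\<forall>n. k n \<in> K n) \<longrightarrow> (\<forall>s\<in>S. \<forall>\<^sub>\<infinity>n. s \<in> V n (k n)))"
    by (rule ex_infinite_selection_sets[OF y S, where V = V], rule opn, assumption, rule cof)
  then obtain K where K: "\<And>n. infinite (K n)"
      "\<And>k s. (\<And>n. k n \<in> K n) \<Longrightarrow> s \<in> S \<Longrightarrow> \<forall>\<^sub>\<infinity>n. s \<in> V n (k n)"
    by blast
  have "infinite (e n ` K n)" for n
    using K(1) inj_e by (metis finite_imageD inj_on_subset subset_UNIV)
  then obtain u where u: "inj u" "\<And>n. u n \<in> e n ` K n"
    using ex_inj_selector[of "\<lambda>n. e n ` K n"] by blast
  obtain k where k: "\<And>n. k n \<in> K n" "\<And>n. u n = e n (k n)"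
    using u(2) unfolding image_iff by metis
  have u_in: "u n \<in> \<U> n" for n
    unfolding k(2) by (rule e)
  have "finite (range u - {U \<in> range u. x \<in> U})" if "x \<in> ?X" for x
  proof -
    obtain s where s: "s \<in> S" "x = cantor_embed s"
      using \<open>x \<in> ?X\<close> by blast
    have "finite {n. x \<notin> u n}"
      using K(2)[OF k(1) s(1)] unfolding eventually_cofinite V_def k(2) s(2) by simp
    then show ?thesis
      by (rule finite_surj[of _ _ u]) auto
  qed
  moreover have "infinite (range u)"
    using u(1) by (rule range_inj_infinite)
  moreover have "range u \<subseteq> Pow ?X" "\<forall>U\<in>range u. openin (top_of_set ?X) U"
    using u_in \<U>(2,4) by blast+
  ultimately have "range u \<in> \<Gamma> (top_of_set ?X)"
    unfolding Gamma_covers_def point_cofinite_cover_def by simp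
  with u_in show "\<exists>U. (\<forall>n. U n \<in> \<U> n) \<and> range U \<in> \<Gamma> (top_of_set ?X)"
    by blast
qed

text \<open>
  The chain may repeat sets, but it cannot have fewer than \<open>\<bb>\<close> distinct members, as their growth
  functions are unbounded. The finite sets contribute only countably many points.
\<close>

lemma card_unbounded_chain_Un_finite:
  assumes y: "unbounded_chain y"
  shows "|y ` Field \<bb> \<union> {s. finite s}| =o \<bb>"
proof (rule ordIso_iff_ordLeq[THEN iffD2], rule conjI)
  have Field: "|Field \<bb>| =o \<bb>"
    by (rule card_of_Field_ordIso[OF Card_order_bounding_number])
  have nat: "|UNIV :: nat set| \<le>o |Field \<bb>|"
    using infinite_Field_bounding_number by (simp add: infinite_iff_card_of_nat)
  have "countable {s :: nat set. finite s}"
    using uncountable_infinite countable_Collect_finite by blast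
  then have "|{s :: nat set. finite s}| \<le>o |UNIV :: nat set|"
    by (auto simp: countable_def card_of_ordLeq[symmetric])
  then have "|{s :: nat set. finite s}| \<le>o \<bb>"
    by (rule ordLeq_transitive[OF _ ordLeq_ordIso_trans[OF nat Field]])
  moreover have "|y ` Field \<bb>| \<le>o \<bb>"
    using card_of_image Field by (rule ordLeq_ordIso_trans)
  ultimately show "|y ` Field \<bb> \<union> {s. finite s}| \<le>o \<bb>"
    using infinite_Field_bounding_number Card_order_bounding_number
    by (intro card_of_Un_ordLeq_infinite_Field)
  have "\<bb> \<le>o |next_elem ` y ` Field \<bb>|"
    using y bounding_number(2) unfolding unbounded_chain_def image_image by blast
  also have "|next_elem ` y ` Field \<bb>| \<le>o |y ` Field \<bb>|"
    by (rule card_of_image)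
  also have "|y ` Field \<bb>| \<le>o |y ` Field \<bb> \<union> {s. finite s}|"
    by (rule card_of_mono1) simp
  finally (ordLeq_transitive) show "\<bb> \<le>o |y ` Field \<bb> \<union> {s. finite s}|" .
qed

theorem theorem2p3:
  fixes \<kappa> :: "'k rel" and T :: "nat set set"
  assumes "tower \<kappa> T" and "unbounded_family T"
  shows "\<exists>X :: real set. |X| =o \<bb> \<and> S\<^sub>1 (\<Gamma> (top_of_set X)) (\<Gamma> (top_of_set X))"
proof -
  obtain y where y: "unbounded_chain y"
    using ex_unbounded_chain[OF assms] by blast
  define S where "S = y ` Field \<bb> \<union> {s. finite s}"
  have "|cantor_embed ` S| =o |S|"
    by (meson card_of_ordIsoI inj_cantor_embed inj_on_imp_bij_betw inj_on_subset ordIso_symmetric subset_UNIV)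
  also have "|S| =o \<bb>"
    unfolding S_def by (rule card_unbounded_chain_Un_finite[OF y])
  finally (ordIso_transitive) have "|cantor_embed ` S| =o \<bb>" .
  then show ?thesis
    using S1_Gamma_cantor_embed[OF y S_def] by blast
qed

end
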